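(* Let $t=(t_{j,a},\bar t_{j,b})$, $j\ge1$, $a=1,\dots,p_1$, $b=1,\dots,p_2$, be real parameters and define $g(t)=W_0(t)\,g\,\bar W_0(t)^{-1}$. Then $g(t)$ is the moment matrix (for the same $\mu$ and compositions) associated with the deformed weights $$w_{1,a}(x,t)=\mathcal E_a(x,t)w_{1,a}(x),\quad \mathcal E_a=\exp\Big(\sum_{j\ge1}t_{j,a}x^j\Big),\qquad w_{2,b}(x,t)=\bar{\mathcal E}_b(x,t)^{-1}w_{2,b}(x),\quad\bar{\mathcal E}_b=\exp\Big(\sum_{j\ge1}\bar t_{j,b}x^j\Big),$$ i.e. $g(t)_{i,j}=\int x^{k_1(i)+k_2(j)}w_{1,a_1(i)}(x,t)w_{2,a_2(j)}(x,t)d\mu(x)$.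
   Context: $\mu$ finite Borel measure on an interval; weights $w_{1,a}$ ($a\le p_1$), $w_{2,b}$ ($b\le p_2$); compositions $\vec n_\ell\in\mathbb N^{p_\ell}$; each $i\in\mathbb Z_+$ is uniquely $i=q|\vec n_\ell|+n_{\ell,1}+\dots+n_{\ell,a-1}+r$ ($0\le r<n_{\ell,a}$), $a_\ell(i)=a$, $k_\ell(i)=qn_{\ell,a}+r$; moment matrix $g_{i,j}=\int x^{k_1(i)+k_2(j)}w_{1,a_1(i)}w_{2,a_2(j)}d\mu$. All series and integrals involved (including those with the exponential factors) are assumed convergent, e.g. as when $\mu$ has bounded support. $e_{\ell,a}(k)=e_i$ for the unique $i$ with $a_\ell(i)=a,k_\ell(i)=k$; $\Lambda_{\ell,a}=\sum_ke_{\ell,a}(k)e_{\ell,a}(k+1)^\top$. $W_0(t)=\exp\big(\sum_{a=1}^{p_1}\sum_{j\ge1}t_{j,a}\Lambda_{1,a}^j\big)$ (upper triangular) and $\bar W_0(t)=\exp\big(\sum_{b=1}^{p_2}\sum_{j\ge1}\bar t_{j,b}(\Lambda_{2,b}^\top)^j\big)$ (lower triangular); each entry of these exponentials is a finite polynomial in the times. *)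

theory Defs
  imports "HOL-Analysis.Analysis"
begin

text \<open>Infinite matrices indexed by nat (rows/columns start at 0).\<close>
type_synonym imat = "nat \<Rightarrow> nat \<Rightarrow> real"

definition imult :: "imat \<Rightarrow> imat \<Rightarrow> imat" where
  "imult A B = (\<lambda>i j. \<Sum>l. A i l * B l j)"

definition iid :: imat where
  "iid = (\<lambda>i j. if i = j then 1 else 0)"

fun ipow :: "imat \<Rightarrow> nat \<Rightarrow> imat" where
  "ipow A 0 = iid"
| "ipow A (Suc n) = imult (ipow A n) A"

definition iexp :: "imat \<Rightarrow> imat" where
  "iexp A = (\<lambda>i j. \<Sum>n. ipow A n i j / fact n)"

definition itrans :: "imat \<Rightarrow> imat" where
  "itrans A = (\<lambda>i j. A j i)"

definition lower_tri :: "imat \<Rightarrow> bool" where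
  "lower_tri A \<longleftrightarrow> (\<forall>i j. i < j \<longrightarrow> A i j = 0)"

definition iinv_lower :: "imat \<Rightarrow> imat" where
  "iinv_lower A = (THE B. lower_tri B \<and> imult A B = iid \<and> imult B A = iid)"

text \<open>Composition \<open>n\<close> with entries \<open>n 1, ..., n p\<close>; \<open>|n|\<close>.\<close>
definition comp_len :: "(nat \<Rightarrow> nat) \<Rightarrow> nat \<Rightarrow> nat" where
  "comp_len n p = (\<Sum>b=1..p. n b)"

definition decomp :: "(nat \<Rightarrow> nat) \<Rightarrow> nat \<Rightarrow> nat \<Rightarrow> nat \<times> nat" where
  "decomp n p i = (THE ak. \<exists>q r. 1 \<le> fst ak \<and> fst ak \<le> p \<and> r < n (fst ak) \<and>
      i = q * comp_len n p + (\<Sum>b=1..<fst ak. n b) + r \<and> snd ak = q * n (fst ak) + r)"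

definition mo_a :: "(nat \<Rightarrow> nat) \<Rightarrow> nat \<Rightarrow> nat \<Rightarrow> nat" where
  "mo_a n p i = fst (decomp n p i)"

definition mo_k :: "(nat \<Rightarrow> nat) \<Rightarrow> nat \<Rightarrow> nat \<Rightarrow> nat" where
  "mo_k n p i = snd (decomp n p i)"

text \<open>\<open>\<Lambda>_a = \<Sum>_k e_a(k) e_a(k+1)^T\<close>, where \<open>e_a(k) = e_i\<close> for the unique \<open>i\<close>
  with \<open>a(i) = a\<close>, \<open>k(i) = k\<close>.\<close>
definition shiftmat :: "(nat \<Rightarrow> nat) \<Rightarrow> nat \<Rightarrow> nat \<Rightarrow> imat" where
  "shiftmat n p a = (\<lambda>i i'. if mo_a n p i = a \<and> mo_a n p i' = a \<and> mo_k n p i' = Suc (mo_k n p i)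
                             then 1 else 0)"

text \<open>Times: \<open>t j a\<close> stands for \<open>t_{j,a}\<close> (only \<open>j \<ge> 1\<close> is used).\<close>
definition W0 :: "(nat \<Rightarrow> nat) \<Rightarrow> nat \<Rightarrow> (nat \<Rightarrow> nat \<Rightarrow> real) \<Rightarrow> imat" where
  "W0 n1 p1 t = iexp (\<lambda>i i'. \<Sum>a=1..p1. \<Sum>j. t (Suc j) a * ipow (shiftmat n1 p1 a) (Suc j) i i')"

definition Wbar0 :: "(nat \<Rightarrow> nat) \<Rightarrow> nat \<Rightarrow> (nat \<Rightarrow> nat \<Rightarrow> real) \<Rightarrow> imat" where
  "Wbar0 n2 p2 tb = iexp (\<lambda>i i'. \<Sum>b=1..p2. \<Sum>j. tb (Suc j) b * ipow (itrans (shiftmat n2 p2 b)) (Suc j) i i')"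

definition moment_matrix :: "real measure \<Rightarrow> (nat \<Rightarrow> nat) \<Rightarrow> nat \<Rightarrow> (nat \<Rightarrow> nat) \<Rightarrow> nat \<Rightarrow>
    (nat \<Rightarrow> real \<Rightarrow> real) \<Rightarrow> (nat \<Rightarrow> real \<Rightarrow> real) \<Rightarrow> imat" where
  "moment_matrix M n1 p1 n2 p2 w1 w2 = (\<lambda>i j.
     LINT x|M. x ^ (mo_k n1 p1 i + mo_k n2 p2 j) * w1 (mo_a n1 p1 i) x * w2 (mo_a n2 p2 j) x)"

end

theory Submission
  imports Defs "HOL-Computational_Algebra.Formal_Power_Series"
begin

text \<open>Everything happens block by block. Under \<open>i \<mapsto> (a(i), k(i))\<close> the matrix \<open>\<Lambda>_a\<close> acts as
  multiplication by \<open>X\<close> on the \<open>a\<close>-th block, so \<open>W_0(t)\<close> is the block Toeplitz matrix of the power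
  series \<open>exp (\<Sum>_j t_{j,a} X^j)\<close>, and the inverse of \<open>Wbar_0(t)\<close> is the transposed block Toeplitz
  matrix of \<open>exp (- \<Sum>_j tbar_{j,b} X^j)\<close>. Multiplying a moment matrix on the left by the Toeplitz
  matrix of a series \<open>E\<close> turns its \<open>(i,j)\<close> entry into \<open>\<Sum>_m E_m \<integral> x^(k+k'+m) w_1 w_2 d\<mu>\<close>, which
  is \<open>\<integral> x^(k+k') E(x) w_1 w_2 d\<mu>\<close> by dominated convergence: the partial sums of \<open>\<Sum>_m E_m x^m\<close> are
  bounded by the exponential of the absolutely convergent exponent. Multiplication on the right is
  the transposed statement.\<close>

no_notation vec_nth (infixl \<open>$\<close> 90)
notation fps_nth (infixl \<open>$\<close> 75)

subsection \<open>Indexing by compositions\<close>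

definition composition :: "(nat \<Rightarrow> nat) \<Rightarrow> nat \<Rightarrow> bool" where
  "composition n p \<longleftrightarrow> p \<ge> 1 \<and> (\<forall>a\<in>{1..p}. n a \<ge> 1)"

definition comp_offset :: "(nat \<Rightarrow> nat) \<Rightarrow> nat \<Rightarrow> nat" where
  "comp_offset n a = (\<Sum>b=1..<a. n b)"

text \<open>The index \<open>i\<close> with \<open>a(i) = a\<close> and \<open>k(i) = k\<close>, i.e.\ \<open>e_a(k) = e_i\<close>.\<close>
definition comp_index :: "(nat \<Rightarrow> nat) \<Rightarrow> nat \<Rightarrow> nat \<Rightarrow> nat \<Rightarrow> nat" where
  "comp_index n p a k = k div n a * comp_len n p + comp_offset n a + k mod n a"

lemma composition_pos: "composition n p \<Longrightarrow> a \<in> {1..p} \<Longrightarrow> 0 < n a"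
  unfolding composition_def by fastforce

lemma comp_offset_Suc: "1 \<le> a \<Longrightarrow> comp_offset n (Suc a) = comp_offset n a + n a"
  unfolding comp_offset_def by simp

lemma comp_offset_mono: "a \<le> b \<Longrightarrow> comp_offset n a \<le> comp_offset n b"
  unfolding comp_offset_def by (intro sum_mono2) auto

lemma comp_offset_add_le: "1 \<le> a \<Longrightarrow> a < b \<Longrightarrow> comp_offset n a + n a \<le> comp_offset n b"
  using comp_offset_Suc[of a n] comp_offset_mono[of "Suc a" b n] by simp

lemma comp_len_eq_comp_offset: "comp_len n p = comp_offset n (Suc p)"
  unfolding comp_len_def comp_offset_def by (metis atLeastLessThanSuc_atLeastAtMost)

lemma comp_offset_add_less_comp_len:
  assumes "a \<in> {1..p}" "r < n a"
  shows "comp_offset n a + r < comp_len n p"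
  using assms comp_offset_Suc[of a n] comp_offset_mono[of "Suc a" "Suc p" n]
  by (auto simp: comp_len_eq_comp_offset)

lemma comp_decomposition_unique:
  assumes "a \<in> {1..p}" "r < n a" "a' \<in> {1..p}" "r' < n a'"
    and eq: "q * comp_len n p + comp_offset n a + r = q' * comp_len n p + comp_offset n a' + r'"
  shows "a = a'" "q = q'" "r = r'"
proof -
  let ?L = "comp_len n p"
  have lt: "comp_offset n a + r < ?L" "comp_offset n a' + r' < ?L"
    using comp_offset_add_less_comp_len assms by auto
  have "(q * ?L + (comp_offset n a + r)) div ?L = (q' * ?L + (comp_offset n a' + r')) div ?L"
    "(q * ?L + (comp_offset n a + r)) mod ?L = (q' * ?L + (comp_offset n a' + r')) mod ?L"
    using eq by (simp_all add: add.assoc)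
  then have q: "q = q'" and off: "comp_offset n a + r = comp_offset n a' + r'"
    using lt by simp_all
  show "a = a'"
  proof (rule ccontr)
    assume "a \<noteq> a'"
    then consider "a < a'" | "a' < a" by linarith
    then show False
      using comp_offset_add_le[of a a' n] comp_offset_add_le[of a' a n] assms off by cases auto
  qed
  then show "q = q'" "r = r'" using q off by auto
qed

lemma decomp_comp_index:
  assumes "composition n p" "a \<in> {1..p}"
  shows "decomp n p (comp_index n p a k) = (a, k)"
  unfolding decomp_def
proof (rule the_equality)
  have na: "0 < n a" using composition_pos[OF assms] .
  then show "\<exists>q r. 1 \<le> fst (a, k) \<and> fst (a, k) \<le> p \<and> r < n (fst (a, k)) \<and>
      comp_index n p a k = q * comp_len n p + (\<Sum>b = 1..<fst (a, k). n b) + r \<and>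
      snd (a, k) = q * n (fst (a, k)) + r"
    using assms(2) by (auto simp: comp_index_def comp_offset_def) (metis div_mult_mod_eq mod_less_divisor)
  fix ak assume "\<exists>q r. 1 \<le> fst ak \<and> fst ak \<le> p \<and> r < n (fst ak) \<and>
      comp_index n p a k = q * comp_len n p + (\<Sum>b = 1..<fst ak. n b) + r \<and> snd ak = q * n (fst ak) + r"
  then obtain q r where h: "fst ak \<in> {1..p}" "r < n (fst ak)"
    "k div n a * comp_len n p + comp_offset n a + k mod n a = q * comp_len n p + comp_offset n (fst ak) + r"
    "snd ak = q * n (fst ak) + r"
    unfolding comp_index_def comp_offset_def by auto
  note u = comp_decomposition_unique[OF assms(2) mod_less_divisor[OF na] h(1-3)]
  then have "snd ak = k" using h(4) by (metis div_mult_mod_eq)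
  then show "ak = (a, k)" using u(1) by (cases ak) auto
qed

lemma mo_a_comp_index [simp]: "composition n p \<Longrightarrow> a \<in> {1..p} \<Longrightarrow> mo_a n p (comp_index n p a k) = a"
  and mo_k_comp_index [simp]: "composition n p \<Longrightarrow> a \<in> {1..p} \<Longrightarrow> mo_k n p (comp_index n p a k) = k"
  using decomp_comp_index unfolding mo_a_def mo_k_def by (metis fst_conv, metis snd_conv)

lemma comp_index_surj:
  assumes "composition n p"
  shows "\<exists>a\<in>{1..p}. \<exists>k. i = comp_index n p a k"
proof -
  let ?L = "comp_len n p"
  have p: "1 \<le> p" "1 \<le> n 1" using assms unfolding composition_def by auto
  then have "0 < ?L" using comp_offset_add_less_comp_len[of 1 p 0 n] by auto
  define \<rho> where "\<rho> = i mod ?L"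
  have \<rho>: "\<rho> < ?L" using \<open>0 < ?L\<close> by (simp add: \<rho>_def)
  define S where "S = {a\<in>{1..p}. comp_offset n a \<le> \<rho>}"
  have "1 \<in> S" "finite S" using p by (auto simp: S_def comp_offset_def)
  define a where "a = Max S"
  have "a \<in> S" using Max_in[OF \<open>finite S\<close>] \<open>1 \<in> S\<close> by (auto simp: a_def)
  then have a: "a \<in> {1..p}" "comp_offset n a \<le> \<rho>" by (simp_all add: S_def)
  have upper: "\<rho> < comp_offset n a + n a"
  proof (cases "a < p")
    case True
    have "Suc a \<notin> S" using Max_ge[OF \<open>finite S\<close>, of "Suc a"] by (auto simp: a_def)
    then show ?thesis using True a comp_offset_Suc[of a n] by (auto simp: S_def)
  next
    case False
    then show ?thesis using a \<rho> comp_offset_Suc[of p n] by (auto simp: comp_len_eq_comp_offset)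
  qed
  define r where "r = \<rho> - comp_offset n a"
  have r: "r < n a" using a(2) upper by (simp add: r_def)
  define k where "k = i div ?L * n a + r"
  have "comp_index n p a k = i div ?L * ?L + comp_offset n a + r"
    using r by (simp add: comp_index_def k_def)
  also have "\<dots> = i" using a(2) by (simp add: r_def \<rho>_def div_mult_mod_eq)
  finally show ?thesis using a by metis
qed

lemma mo_a_in: "composition n p \<Longrightarrow> mo_a n p i \<in> {1..p}"
  and comp_index_mo [simp]: "composition n p \<Longrightarrow> comp_index n p (mo_a n p i) (mo_k n p i) = i"
  using comp_index_surj[of n p i] by auto

lemma mo_eq_iff: "composition n p \<Longrightarrow> i = j \<longleftrightarrow> mo_a n p i = mo_a n p j \<and> mo_k n p i = mo_k n p j"
  by (metis comp_index_mo)

lemma strict_mono_comp_index: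
  assumes "composition n p" "a \<in> {1..p}"
  shows "strict_mono (comp_index n p a)"
proof (rule strict_monoI)
  fix k k' :: nat assume "k < k'"
  have na: "0 < n a" using composition_pos[OF assms] .
  show "comp_index n p a k < comp_index n p a k'"
  proof (cases "k div n a = k' div n a")
    case True
    then have "k mod n a < k' mod n a" using \<open>k < k'\<close> by (metis div_mult_mod_eq nat_add_left_cancel_less)
    then show ?thesis using True by (simp add: comp_index_def)
  next
    case False
    then have "Suc (k div n a) * comp_len n p \<le> k' div n a * comp_len n p"
      using div_le_mono[of k k' "n a"] \<open>k < k'\<close> by (intro mult_right_mono) auto
    moreover have "comp_offset n a + k mod n a < comp_len n p"
      using comp_offset_add_less_comp_len[OF assms(2)] na by simp
    ultimately show ?thesis by (simp add: comp_index_def)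
  qed
qed

subsection \<open>Block Toeplitz matrices\<close>

definition toeplitz :: "(nat \<Rightarrow> nat) \<Rightarrow> nat \<Rightarrow> (nat \<Rightarrow> real fps) \<Rightarrow> imat" where
  "toeplitz n p F = (\<lambda>i j. if mo_a n p i = mo_a n p j \<and> mo_k n p i \<le> mo_k n p j
      then F (mo_a n p i) $ (mo_k n p j - mo_k n p i) else 0)"

lemma toeplitz_comp_index:
  assumes "composition n p" "a \<in> {1..p}"
  shows "toeplitz n p F (comp_index n p a r) j =
      (if a = mo_a n p j \<and> r \<le> mo_k n p j then F a $ (mo_k n p j - r) else 0)"
    and "toeplitz n p F i (comp_index n p a r) =
      (if mo_a n p i = a \<and> mo_k n p i \<le> r then F a $ (r - mo_k n p i) else 0)"
  using assms by (auto simp: toeplitz_def)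

lemma toeplitz_mult:
  assumes "composition n p"
  shows "imult (toeplitz n p F) (toeplitz n p G) = toeplitz n p (\<lambda>a. F a * G a)"
proof (intro ext)
  fix i j
  define a k k' where "a = mo_a n p i" and "k = mo_k n p i" and "k' = mo_k n p j"
  have a: "a \<in> {1..p}" using mo_a_in[OF assms] by (simp add: a_def)
  have supp: "toeplitz n p F i l * toeplitz n p G l j = 0" if "l \<notin> comp_index n p a ` {k..k'}" for l
  proof (rule ccontr)
    assume "toeplitz n p F i l * toeplitz n p G l j \<noteq> 0"
    then have "mo_a n p l = a" "mo_k n p l \<in> {k..k'}"
      by (auto simp: toeplitz_def a_def k_def k'_def split: if_splits)
    then show False using that comp_index_mo[OF assms, of l] by force
  qed
  have "imult (toeplitz n p F) (toeplitz n p G) i j =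
      (\<Sum>l\<in>comp_index n p a ` {k..k'}. toeplitz n p F i l * toeplitz n p G l j)"
    unfolding imult_def by (rule suminf_finite) (use supp in auto)
  also have "\<dots> = (\<Sum>r=k..k'. toeplitz n p F i (comp_index n p a r) * toeplitz n p G (comp_index n p a r) j)"
    using strict_mono_comp_index[OF assms a]
    by (intro sum.reindex[unfolded comp_def]) (simp add: strict_mono_imp_inj_on)
  also have "\<dots> = (\<Sum>r=k..k'. F a $ (r - k) * (if a = mo_a n p j then G a $ (k' - r) else 0))"
    using assms a by (intro sum.cong) (auto simp: toeplitz_comp_index a_def k_def k'_def)
  also have "\<dots> = toeplitz n p (\<lambda>a. F a * G a) i j"
  proof (cases "a = mo_a n p j \<and> k \<le> k'")
    case True
    have "(\<Sum>r=k..k'. F a $ (r - k) * G a $ (k' - r)) = (\<Sum>s=0..k'-k. F a $ s * G a $ (k' - k - s))"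
      using True sum.shift_bounds_cl_nat_ivl[of "\<lambda>r. F a $ (r - k) * G a $ (k' - r)" 0 k "k' - k"]
      by (simp add: add.commute)
    then show ?thesis using True by (simp add: toeplitz_def a_def k_def k'_def fps_mult_nth)
  qed (auto simp: toeplitz_def a_def k_def k'_def)
  finally show "imult (toeplitz n p F) (toeplitz n p G) i j = toeplitz n p (\<lambda>a. F a * G a) i j" .
qed

lemma toeplitz_one:
  assumes "composition n p"
  shows "toeplitz n p (\<lambda>_. 1) = iid"
proof (intro ext)
  fix i j
  show "toeplitz n p (\<lambda>_. 1) i j = iid i j"
    using mo_eq_iff[OF assms, of i j] by (auto simp: toeplitz_def iid_def)
qed

lemma ipow_toeplitz: "composition n p \<Longrightarrow> ipow (toeplitz n p F) m = toeplitz n p (\<lambda>a. F a ^ m)"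
  by (induction m) (simp_all add: toeplitz_one toeplitz_mult mult.commute)

lemma iexp_toeplitz:
  assumes "composition n p" and "\<And>a. F a $ 0 = 0"
  shows "iexp (toeplitz n p F) = toeplitz n p (\<lambda>a. fps_exp 1 oo F a)"
proof (intro ext)
  fix i j
  show "iexp (toeplitz n p F) i j = toeplitz n p (\<lambda>a. fps_exp 1 oo F a) i j"
  proof (cases "mo_a n p i = mo_a n p j \<and> mo_k n p i \<le> mo_k n p j")
    case True
    define a m where "a = mo_a n p i" and "m = mo_k n p j - mo_k n p i"
    \<comment> \<open>only the powers \<open>e \<le> m\<close> contribute since \<open>F a\<close> has no constant term\<close>
    have "iexp (toeplitz n p F) i j = (\<Sum>e. (F a ^ e) $ m / fact e)"
      unfolding iexp_def ipow_toeplitz[OF assms(1)] using True by (simp add: toeplitz_def a_def m_def)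
    also have "\<dots> = (\<Sum>e=0..m. (F a ^ e) $ m / fact e)"
      by (rule suminf_finite) (auto simp: startsby_zero_power_prefix[OF assms(2)])
    also have "\<dots> = (fps_exp 1 oo F a) $ m"
      by (simp add: fps_compose_nth)
    finally show ?thesis using True by (simp add: toeplitz_def a_def m_def)
  next
    case False
    then have "toeplitz n p G i j = 0" for G by (auto simp: toeplitz_def)
    then show ?thesis unfolding iexp_def ipow_toeplitz[OF assms(1)] by simp
  qed
qed

lemma imult_itrans: "imult (itrans A) (itrans B) = itrans (imult B A)"
  unfolding imult_def itrans_def by (simp add: mult.commute)

lemma itrans_iid: "itrans iid = iid"
  by (auto simp: fun_eq_iff itrans_def iid_def)

lemma ipow_itrans_toeplitz:
  "composition n p \<Longrightarrow> ipow (itrans (toeplitz n p F)) m = itrans (toeplitz n p (\<lambda>a. F a ^ m))"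
  by (induction m) (simp_all add: toeplitz_one itrans_iid imult_itrans toeplitz_mult)

lemma iexp_itrans_toeplitz:
  assumes "composition n p" and "\<And>a. F a $ 0 = 0"
  shows "iexp (itrans (toeplitz n p F)) = itrans (toeplitz n p (\<lambda>a. fps_exp 1 oo F a))"
proof (intro ext)
  fix i j
  have "iexp (itrans (toeplitz n p F)) i j = iexp (toeplitz n p F) j i"
    unfolding iexp_def ipow_itrans_toeplitz[OF assms(1)] ipow_toeplitz[OF assms(1)]
    by (simp add: itrans_def)
  then show "iexp (itrans (toeplitz n p F)) i j = itrans (toeplitz n p (\<lambda>a. fps_exp 1 oo F a)) i j"
    by (simp add: iexp_toeplitz[OF assms] itrans_def)
qed

lemma shiftmat_eq_toeplitz: "shiftmat n p a = toeplitz n p (\<lambda>a'. if a' = a then fps_X else 0)"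
  by (auto simp: fun_eq_iff shiftmat_def toeplitz_def)

lemma ipow_shiftmat:
  assumes "composition n p"
  shows "ipow (shiftmat n p a) (Suc m) = toeplitz n p (\<lambda>a'. if a' = a then fps_X ^ Suc m else 0)"
proof -
  have "ipow (shiftmat n p a) (Suc m) = toeplitz n p (\<lambda>a'. (if a' = a then fps_X else 0) ^ Suc m)"
    by (simp only: shiftmat_eq_toeplitz ipow_toeplitz[OF assms])
  also have "(\<lambda>a'. (if a' = a then fps_X else 0) ^ Suc m) = (\<lambda>a'. if a' = a then fps_X ^ Suc m else 0)"
    by auto
  finally show ?thesis .
qed

definition time_fps :: "(nat \<Rightarrow> nat \<Rightarrow> real) \<Rightarrow> nat \<Rightarrow> real fps" where
  "time_fps t a = Abs_fps (\<lambda>m. if m = 0 then 0 else t m a)"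

lemma time_fps_nth: "time_fps t a $ m = (if m = 0 then 0 else t m a)"
  by (simp add: time_fps_def)

lemma toeplitz_time_fps:
  assumes "composition n p"
  shows "(\<lambda>i i'. \<Sum>a=1..p. \<Sum>j. t (Suc j) a * ipow (shiftmat n p a) (Suc j) i i') = toeplitz n p (time_fps t)"
proof (intro ext)
  fix i i'
  define m where "m = mo_k n p i' - mo_k n p i"
  let ?block = "mo_a n p i = mo_a n p i' \<and> mo_k n p i \<le> mo_k n p i'"
  have "(\<Sum>j. t (Suc j) a * ipow (shiftmat n p a) (Suc j) i i') =
      (\<Sum>j\<in>{m - 1}. t (Suc j) a * ipow (shiftmat n p a) (Suc j) i i')" for a
    by (rule suminf_finite) (auto simp: ipow_shiftmat[OF assms] toeplitz_def m_def simp del: ipow.simps)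
  also have "\<dots>a = (if ?block \<and> mo_a n p i = a \<and> m \<noteq> 0 then t m a else 0)" for a
    by (auto simp: ipow_shiftmat[OF assms] toeplitz_def m_def Suc_diff_Suc simp del: ipow.simps)
  finally have "(\<Sum>a=1..p. \<Sum>j. t (Suc j) a * ipow (shiftmat n p a) (Suc j) i i') =
      (\<Sum>a=1..p. if ?block \<and> mo_a n p i = a \<and> m \<noteq> 0 then t m a else 0)"
    by simp
  also have "\<dots> = toeplitz n p (time_fps t) i i'"
    using mo_a_in[OF assms, of i] by (simp add: toeplitz_def time_fps_nth m_def)
  finally show "(\<Sum>a=1..p. \<Sum>j. t (Suc j) a * ipow (shiftmat n p a) (Suc j) i i') = toeplitz n p (time_fps t) i i'" .
qed

lemma W0_eq_toeplitz: "composition n p \<Longrightarrow> W0 n p t = toeplitz n p (\<lambda>a. fps_exp 1 oo time_fps t a)"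
  unfolding W0_def toeplitz_time_fps by (rule iexp_toeplitz) (simp_all add: time_fps_nth)

lemma Wbar0_eq_itrans_toeplitz:
  assumes "composition n p"
  shows "Wbar0 n p t = itrans (toeplitz n p (\<lambda>a. fps_exp 1 oo time_fps t a))"
proof -
  have "ipow (itrans (shiftmat n p a)) m = itrans (ipow (shiftmat n p a) m)" for a m
    by (simp only: shiftmat_eq_toeplitz ipow_itrans_toeplitz[OF assms] ipow_toeplitz[OF assms])
  then have "(\<lambda>i i'. \<Sum>a=1..p. \<Sum>j. t (Suc j) a * ipow (itrans (shiftmat n p a)) (Suc j) i i') =
      itrans (\<lambda>i i'. \<Sum>a=1..p. \<Sum>j. t (Suc j) a * ipow (shiftmat n p a) (Suc j) i i')"
    by (simp only: itrans_def)
  then show ?thesis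
    unfolding Wbar0_def toeplitz_time_fps[OF assms] by (simp add: iexp_itrans_toeplitz[OF assms] time_fps_nth)
qed

lemma lower_tri_itrans_toeplitz:
  assumes "composition n p"
  shows "lower_tri (itrans (toeplitz n p F))"
  unfolding lower_tri_def
proof (intro allI impI)
  fix i j :: nat assume "i < j"
  show "itrans (toeplitz n p F) i j = 0"
  proof (rule ccontr)
    assume "itrans (toeplitz n p F) i j \<noteq> 0"
    then have "mo_a n p j = mo_a n p i" "mo_k n p j \<le> mo_k n p i"
      by (auto simp: itrans_def toeplitz_def split: if_splits)
    then have "j \<le> i"
      using strict_mono_less_eq[OF strict_mono_comp_index[OF assms mo_a_in[OF assms]]]
      by (metis comp_index_mo[OF assms])
    then show False using \<open>i < j\<close> by simp
  qed
qed

lemma imult_lower_tri: "lower_tri X \<Longrightarrow> imult X Y i j = (\<Sum>l\<le>i. X i l * Y l j)"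
  unfolding imult_def lower_tri_def by (rule suminf_finite) auto

lemma lower_tri_imult: "lower_tri X \<Longrightarrow> lower_tri Y \<Longrightarrow> lower_tri (imult X Y)"
  by (auto simp: imult_lower_tri lower_tri_def intro!: sum.neutral)

lemma imult_assoc_lower_tri:
  assumes X: "lower_tri X" and Y: "lower_tri Y"
  shows "imult (imult X Y) Z = imult X (imult Y Z)"
proof (intro ext)
  fix i j
  have "imult (imult X Y) Z i j = (\<Sum>l\<le>i. \<Sum>m\<le>i. X i m * Y m l * Z l j)"
    by (simp add: imult_lower_tri[OF lower_tri_imult[OF X Y]] imult_lower_tri[OF X] sum_distrib_right)
  also have "\<dots> = (\<Sum>m\<le>i. \<Sum>l\<le>i. X i m * Y m l * Z l j)"
    by (rule sum.swap)
  also have "\<dots> = (\<Sum>m\<le>i. X i m * (\<Sum>l\<le>m. Y m l * Z l j))"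
  proof (intro sum.cong refl)
    fix m assume "m \<in> {..i}"
    then have "(\<Sum>l\<le>i. Y m l * Z l j) = (\<Sum>l\<le>m. Y m l * Z l j)"
      using Y unfolding lower_tri_def by (intro sum.mono_neutral_right) auto
    moreover have "(\<Sum>l\<le>i. X i m * Y m l * Z l j) = X i m * (\<Sum>l\<le>i. Y m l * Z l j)"
      by (simp add: sum_distrib_left mult.assoc)
    ultimately show "(\<Sum>l\<le>i. X i m * Y m l * Z l j) = X i m * (\<Sum>l\<le>m. Y m l * Z l j)"
      by simp
  qed
  also have "\<dots> = imult X (imult Y Z) i j"
    by (simp add: imult_lower_tri[OF X] imult_lower_tri[OF Y])
  finally show "imult (imult X Y) Z i j = imult X (imult Y Z) i j" .
qed

lemma imult_iid_right [simp]: "imult X iid = X"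
  unfolding imult_def iid_def by (intro ext) (subst suminf_finite[of "{_}"], auto)

lemma imult_iid_left [simp]: "imult iid X = X"
  unfolding imult_def iid_def by (intro ext) (subst suminf_finite[of "{_}"], auto)

lemma iinv_lower_itrans_toeplitz:
  assumes "composition n p" and "\<And>a. C a * D a = 1"
  shows "iinv_lower (itrans (toeplitz n p C)) = itrans (toeplitz n p D)"
  unfolding iinv_lower_def
proof (rule the_equality)
  have CD: "imult (itrans (toeplitz n p C)) (itrans (toeplitz n p D)) = iid"
    and DC: "imult (itrans (toeplitz n p D)) (itrans (toeplitz n p C)) = iid"
    by (simp_all add: imult_itrans toeplitz_mult[OF assms(1)] assms(2) mult.commute
        toeplitz_one[OF assms(1)] itrans_iid)
  then show "lower_tri (itrans (toeplitz n p D)) \<and> imult (itrans (toeplitz n p C)) (itrans (toeplitz n p D)) = iid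
      \<and> imult (itrans (toeplitz n p D)) (itrans (toeplitz n p C)) = iid"
    using lower_tri_itrans_toeplitz[OF assms(1)] by blast
  fix B assume B: "lower_tri B \<and> imult (itrans (toeplitz n p C)) B = iid \<and> imult B (itrans (toeplitz n p C)) = iid"
  have "B = imult B (imult (itrans (toeplitz n p C)) (itrans (toeplitz n p D)))"
    by (simp add: CD)
  also have "\<dots> = imult (imult B (itrans (toeplitz n p C))) (itrans (toeplitz n p D))"
    using B lower_tri_itrans_toeplitz[OF assms(1)] by (intro imult_assoc_lower_tri[symmetric]) auto
  also have "\<dots> = itrans (toeplitz n p D)"
    using B by simp
  finally show "B = itrans (toeplitz n p D)" .
qed

lemma fps_exp_compose_mult_inverse:
  assumes "T $ 0 = 0"
  shows "(fps_exp 1 oo T) * (fps_exp (-1) oo T) = (1 :: 'a :: field_char_0 fps)"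
  using fps_exp_add_mult[of "1::'a" "-1"]
  by (simp add: fps_compose_mult_distrib[OF assms, symmetric])

subsection \<open>Evaluating power series and their exponentials\<close>

lemma fps_mult_eval_sums:
  fixes F G :: "'a :: {real_normed_field, banach} fps"
  assumes F: "summable (\<lambda>j. norm (F $ j * x ^ j))" and G: "summable (\<lambda>j. norm (G $ j * x ^ j))"
  shows "(\<lambda>m. (F * G) $ m * x ^ m) sums ((\<Sum>j. F $ j * x ^ j) * (\<Sum>j. G $ j * x ^ j))"
    and "summable (\<lambda>m. norm ((F * G) $ m * x ^ m))"
    and "(\<Sum>m. norm ((F * G) $ m * x ^ m)) \<le> (\<Sum>j. norm (F $ j * x ^ j)) * (\<Sum>j. norm (G $ j * x ^ j))"
proof -
  define f g where "f = (\<lambda>r. F $ r * x ^ r)" and "g = (\<lambda>r. G $ r * x ^ r)"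
  have conv: "(F * G) $ m * x ^ m = (\<Sum>r\<le>m. f r * g (m - r))" for m
  proof -
    have "(F * G) $ m * x ^ m = (\<Sum>r\<le>m. F $ r * G $ (m - r) * x ^ m)"
      by (simp add: fps_mult_nth atLeast0AtMost sum_distrib_right)
    also have "\<dots> = (\<Sum>r\<le>m. f r * g (m - r))"
    proof (intro sum.cong refl)
      fix r assume "r \<in> {..m}"
      then have "x ^ m = x ^ r * x ^ (m - r)" by (simp add: power_add[symmetric])
      then show "F $ r * G $ (m - r) * x ^ m = f r * g (m - r)"
        by (simp add: f_def g_def mult_ac)
    qed
    finally show ?thesis .
  qed
  have f: "summable (\<lambda>r. norm (f r))" and g: "summable (\<lambda>r. norm (g r))"
    using F G by (simp_all add: f_def g_def)
  have abs_prod: "(\<lambda>m. \<Sum>r\<le>m. norm (f r) * norm (g (m - r))) sums ((\<Sum>r. norm (f r)) * (\<Sum>r. norm (g r)))"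
    using Cauchy_product_sums[of "\<lambda>r. norm (f r)" "\<lambda>r. norm (g r)"] f g by simp
  have le: "norm ((F * G) $ m * x ^ m) \<le> (\<Sum>r\<le>m. norm (f r) * norm (g (m - r)))" for m
    unfolding conv by (rule order_trans[OF norm_sum]) (simp add: norm_mult)
  show "(\<lambda>m. (F * G) $ m * x ^ m) sums ((\<Sum>j. F $ j * x ^ j) * (\<Sum>j. G $ j * x ^ j))"
    unfolding conv using Cauchy_product_sums[OF f g] by (simp add: f_def g_def)
  show summ: "summable (\<lambda>m. norm ((F * G) $ m * x ^ m))"
    using le by (intro summable_comparison_test'[OF sums_summable[OF abs_prod], of 0]) auto
  show "(\<Sum>m. norm ((F * G) $ m * x ^ m)) \<le> (\<Sum>j. norm (F $ j * x ^ j)) * (\<Sum>j. norm (G $ j * x ^ j))"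
    using suminf_le[OF le summ sums_summable[OF abs_prod]] abs_prod by (simp add: sums_iff f_def g_def)
qed

lemma fps_power_eval_sums:
  fixes T :: "'a :: {real_normed_field, banach} fps"
  assumes T: "summable (\<lambda>j. norm (T $ j * x ^ j))"
  shows "(\<lambda>m. (T ^ i) $ m * x ^ m) sums ((\<Sum>j. T $ j * x ^ j) ^ i) \<and>
    summable (\<lambda>m. norm ((T ^ i) $ m * x ^ m)) \<and>
    (\<Sum>m. norm ((T ^ i) $ m * x ^ m)) \<le> (\<Sum>j. norm (T $ j * x ^ j)) ^ i"
proof (induction i)
  case 0
  have "(\<lambda>m. (T ^ 0) $ m * x ^ m) = (\<lambda>m. if m = 0 then 1 else 0)"
    and "(\<lambda>m. norm ((T ^ 0) $ m * x ^ m)) = (\<lambda>m. if m = 0 then 1 else 0)"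
    by auto
  then show ?case using sums_single[of 0 "\<lambda>_. 1::'a"] sums_single[of 0 "\<lambda>_. 1::real"]
    by (simp add: sums_iff)
next
  case (Suc i)
  then have IH: "(\<lambda>m. (T ^ i) $ m * x ^ m) sums ((\<Sum>j. T $ j * x ^ j) ^ i)"
    "summable (\<lambda>m. norm ((T ^ i) $ m * x ^ m))"
    "(\<Sum>m. norm ((T ^ i) $ m * x ^ m)) \<le> (\<Sum>j. norm (T $ j * x ^ j)) ^ i"
    by blast+
  note prod = fps_mult_eval_sums[OF T IH(2), unfolded power_Suc[symmetric] sums_unique[OF IH(1), symmetric]]
  have "(\<Sum>m. norm ((T ^ Suc i) $ m * x ^ m)) \<le> (\<Sum>j. norm (T $ j * x ^ j)) * (\<Sum>m. norm ((T ^ i) $ m * x ^ m))"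
    by (rule prod(3))
  also have "\<dots> \<le> (\<Sum>j. norm (T $ j * x ^ j)) ^ Suc i"
    using IH(3) T by (simp add: mult_left_mono suminf_nonneg)
  finally show ?case using prod(1,2) by simp
qed

lemma sums_triangular_columns:
  fixes g :: "nat \<Rightarrow> nat \<Rightarrow> 'a :: banach"
  assumes "((\<lambda>(i, m). g i m) has_sum S) (UNIV \<times> UNIV)" and "\<And>i m. m < i \<Longrightarrow> g i m = 0"
  shows "(\<lambda>m. \<Sum>i\<le>m. g i m) sums S"
proof -
  have "((\<lambda>i. g i m) has_sum (\<Sum>i\<le>m. g i m)) UNIV \<longleftrightarrow> ((\<lambda>i. g i m) has_sum (\<Sum>i\<le>m. g i m)) {..m}" for m
    by (rule has_sum_cong_neutral) (auto simp: assms(2) not_le)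
  then have col: "((\<lambda>i. g i m) has_sum (\<Sum>i\<le>m. g i m)) UNIV" for m
    by simp
  have "((\<lambda>(m, i). g i m) has_sum S) (UNIV \<times> UNIV)"
    using has_sum_swap[where f = "\<lambda>(i, m). g i m" and A = UNIV and B = UNIV] assms(1)
    by (simp del: UNIV_Times_UNIV)
  then have "((\<lambda>m. \<Sum>i\<le>m. g i m) has_sum S) UNIV"
    by (rule has_sum_SigmaD) (simp add: col)
  then show ?thesis by (rule has_sum_imp_sums)
qed

lemma sums_triangular_swap:
  fixes g :: "nat \<Rightarrow> nat \<Rightarrow> 'a :: banach"
  assumes rows: "\<And>i. (\<lambda>m. g i m) sums r i" "\<And>i. summable (\<lambda>m. norm (g i m))"
    and abs: "summable (\<lambda>i. \<Sum>m. norm (g i m))"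
    and triangular: "\<And>i m. m < i \<Longrightarrow> g i m = 0"
  shows "(\<lambda>m. \<Sum>i\<le>m. g i m) sums (\<Sum>i. r i)"
    and "summable (\<lambda>m. norm (\<Sum>i\<le>m. g i m))"
    and "(\<Sum>m. norm (\<Sum>i\<le>m. g i m)) \<le> (\<Sum>i. \<Sum>m. norm (g i m))"
proof -
  define N where "N = (\<lambda>i. \<Sum>m. norm (g i m))"
  have N_has: "((\<lambda>m. norm (g i m)) has_sum N i) UNIV" for i
    using rows(2) by (simp add: N_def sums_nonneg_imp_has_sum summable_sums)
  have N_nonneg: "0 \<le> N i" for i
    using rows(2) by (simp add: N_def suminf_nonneg)
  have norm_summable: "(\<lambda>(i, m). norm (g i m)) summable_on UNIV \<times> UNIV"
    using N_has abs N_nonneg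
    by (intro summable_on_SigmaI[where g = N]) (auto intro: summable_nonneg_imp_summable_on simp: N_def)
  define S S' where "S = infsum (\<lambda>(i, m). g i m) (UNIV \<times> UNIV)"
    and "S' = infsum (\<lambda>(i, m). norm (g i m)) (UNIV \<times> UNIV)"
  have S: "((\<lambda>(i, m). g i m) has_sum S) (UNIV \<times> UNIV)"
    using abs_summable_summable[of "\<lambda>(i, m). g i m"] norm_summable
    by (simp add: S_def case_prod_unfold)
  have S': "((\<lambda>(i, m). norm (g i m)) has_sum S') (UNIV \<times> UNIV)"
    using norm_summable by (simp add: S'_def)
  have "(r has_sum S) UNIV"
    using rows by (intro has_sum_SigmaD[OF S]) (auto intro: norm_summable_imp_has_sum)
  then have "(\<Sum>i. r i) = S" by (simp add: has_sum_imp_sums sums_unique[symmetric])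
  then show "(\<lambda>m. \<Sum>i\<le>m. g i m) sums (\<Sum>i. r i)"
    using sums_triangular_columns[OF S triangular] by simp
  have "(N has_sum S') UNIV"
    using N_has by (intro has_sum_SigmaD[OF S']) auto
  then have N_sums: "N sums S'" by (rule has_sum_imp_sums)
  have col: "(\<lambda>m. \<Sum>i\<le>m. norm (g i m)) sums S'"
    using sums_triangular_columns[OF S'] triangular by simp
  have le: "norm (\<Sum>i\<le>m. g i m) \<le> (\<Sum>i\<le>m. norm (g i m))" for m
    by (rule norm_sum)
  show summ: "summable (\<lambda>m. norm (\<Sum>i\<le>m. g i m))"
    using le by (intro summable_comparison_test'[OF sums_summable[OF col], of 0]) auto
  show "(\<Sum>m. norm (\<Sum>i\<le>m. g i m)) \<le> (\<Sum>i. \<Sum>m. norm (g i m))"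
    using suminf_le[OF le summ sums_summable[OF col]] col N_sums by (simp add: sums_iff N_def)
qed

lemma exp_real_sums: "(\<lambda>n. y ^ n / fact n) sums exp (y :: real)"
  using exp_converges[of y] by (simp add: divide_inverse mult.commute)

lemma fps_exp_compose_eval_sums:
  fixes T :: "real fps" and c x :: real
  assumes T0: "T $ 0 = 0" and T: "summable (\<lambda>j. norm (T $ j * x ^ j))"
  shows "(\<lambda>m. (fps_exp c oo T) $ m * x ^ m) sums exp (c * (\<Sum>j. T $ j * x ^ j))"
    and "summable (\<lambda>m. norm ((fps_exp c oo T) $ m * x ^ m))"
    and "(\<Sum>m. norm ((fps_exp c oo T) $ m * x ^ m)) \<le> exp (\<bar>c\<bar> * (\<Sum>j. norm (T $ j * x ^ j)))"
proof -
  define s \<sigma> where "s = (\<Sum>j. T $ j * x ^ j)" and "\<sigma> = (\<Sum>j. norm (T $ j * x ^ j))"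
  define g where "g = (\<lambda>i m. c ^ i / fact i * ((T ^ i) $ m * x ^ m))"
  have P: "(\<lambda>m. (T ^ i) $ m * x ^ m) sums s ^ i" "summable (\<lambda>m. norm ((T ^ i) $ m * x ^ m))"
    "(\<Sum>m. norm ((T ^ i) $ m * x ^ m)) \<le> \<sigma> ^ i" for i
    using fps_power_eval_sums[OF T, of i] by (simp_all add: s_def \<sigma>_def)
  have rows: "(\<lambda>m. g i m) sums ((c * s) ^ i / fact i)" for i
    using sums_mult[OF P(1), of "c ^ i / fact i"] by (simp add: g_def power_mult_distrib)
  have row_norm: "(\<lambda>m. norm (g i m)) = (\<lambda>m. \<bar>c\<bar> ^ i / fact i * norm ((T ^ i) $ m * x ^ m))" for i
    by (simp add: g_def abs_mult power_abs)
  have row_abs: "summable (\<lambda>m. norm (g i m))" for i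
    unfolding row_norm by (intro summable_mult P(2))
  have row_le: "(\<Sum>m. norm (g i m)) \<le> (\<bar>c\<bar> * \<sigma>) ^ i / fact i" for i
    unfolding row_norm suminf_mult[OF P(2)] power_mult_distrib
    using mult_left_mono[OF P(3), of "\<bar>c\<bar> ^ i / fact i"] by simp
  have abs: "summable (\<lambda>i. \<Sum>m. norm (g i m))"
    using row_le row_abs
    by (intro summable_comparison_test'[OF sums_summable[OF exp_real_sums[of "\<bar>c\<bar> * \<sigma>"]], of 0])
      (simp add: suminf_nonneg)
  have triangular: "g i m = 0" if "m < i" for i m
    using startsby_zero_power_prefix[OF T0] that by (simp add: g_def)
  have columns: "(\<Sum>i\<le>m. g i m) = (fps_exp c oo T) $ m * x ^ m" for m
    by (simp add: g_def fps_compose_nth atLeast0AtMost sum_distrib_left sum_distrib_right mult_ac)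
  note swap = sums_triangular_swap[OF rows row_abs abs triangular, unfolded columns]
  show "(\<lambda>m. (fps_exp c oo T) $ m * x ^ m) sums exp (c * (\<Sum>j. T $ j * x ^ j))"
    using swap(1) exp_real_sums[of "c * s"] by (simp add: sums_iff s_def)
  show "summable (\<lambda>m. norm ((fps_exp c oo T) $ m * x ^ m))"
    by (rule swap(2))
  show "(\<Sum>m. norm ((fps_exp c oo T) $ m * x ^ m)) \<le> exp (\<bar>c\<bar> * (\<Sum>j. norm (T $ j * x ^ j)))"
    using swap(3) suminf_le[OF row_le abs sums_summable[OF exp_real_sums]] exp_real_sums[of "\<bar>c\<bar> * \<sigma>"]
    by (simp add: sums_iff \<sigma>_def)
qed

lemma sums_integral_dominated:
  fixes f :: "nat \<Rightarrow> 'a \<Rightarrow> 'b :: {banach, second_countable_topology}"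
  assumes f: "\<And>m. integrable M (f m)" and S: "S \<in> borel_measurable M" and w: "integrable M w"
    and sums: "AE x in M. (\<lambda>m. f m x) sums S x"
    and bound: "\<And>N. AE x in M. norm (\<Sum>m<N. f m x) \<le> w x"
  shows "(\<lambda>m. integral\<^sup>L M (f m)) sums integral\<^sup>L M S"
proof -
  have "(\<lambda>N. integral\<^sup>L M (\<lambda>x. \<Sum>m<N. f m x)) \<longlonglongrightarrow> integral\<^sup>L M S"
    using f sums bound by (intro integral_dominated_convergence[OF S _ w]) (auto simp: sums_def)
  then show ?thesis
    using f by (simp add: sums_def integral_sum)
qed

lemma sums_integral_power_series:
  fixes E :: "nat \<Rightarrow> real" and S A h :: "real \<Rightarrow> real"
  assumes M: "sets M = sets borel" and [measurable]: "S \<in> borel_measurable M" "h \<in> borel_measurable M"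
    and pointwise: "AE x in M. (\<lambda>m. E m * x ^ m) sums S x \<and>
      summable (\<lambda>m. norm (E m * x ^ m)) \<and> (\<Sum>m. norm (E m * x ^ m)) \<le> A x"
    and int_m: "\<And>m. integrable M (\<lambda>x. x ^ (s + m) * h x)"
    and int: "integrable M (\<lambda>x. \<bar>x\<bar> ^ s * A x * \<bar>h x\<bar>)"
  shows "(\<lambda>m. E m * (LINT x|M. x ^ (s + m) * h x)) sums (LINT x|M. x ^ s * S x * h x)"
proof -
  note [measurable] = measurable_ident_sets[OF M]
  have bound: "AE x in M. norm (\<Sum>m<N. E m * (x ^ (s + m) * h x)) \<le> \<bar>x\<bar> ^ s * A x * \<bar>h x\<bar>" for N
    using pointwise
  proof eventually_elim
    case (elim x)
    have "(\<Sum>m<N. E m * (x ^ (s + m) * h x)) = (\<Sum>m<N. E m * x ^ m) * (x ^ s * h x)"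
      unfolding sum_distrib_right by (intro sum.cong refl) (simp add: power_add mult_ac)
    then have "norm (\<Sum>m<N. E m * (x ^ (s + m) * h x)) = norm (\<Sum>m<N. E m * x ^ m) * (\<bar>x\<bar> ^ s * \<bar>h x\<bar>)"
      by (simp add: abs_mult power_abs)
    also have "\<dots> \<le> (\<Sum>m. norm (E m * x ^ m)) * (\<bar>x\<bar> ^ s * \<bar>h x\<bar>)"
      using elim by (intro mult_right_mono order_trans[OF norm_sum sum_le_suminf]) auto
    also have "\<dots> \<le> A x * (\<bar>x\<bar> ^ s * \<bar>h x\<bar>)"
      using elim by (intro mult_right_mono) auto
    finally show ?case by (simp add: mult_ac)
  qed
  have sums: "AE x in M. (\<lambda>m. E m * (x ^ (s + m) * h x)) sums (x ^ s * S x * h x)"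
    using pointwise
  proof eventually_elim
    case (elim x)
    then have "(\<lambda>m. E m * x ^ m * (x ^ s * h x)) sums (S x * (x ^ s * h x))"
      by (intro sums_mult2) simp
    then show ?case by (simp add: power_add mult_ac)
  qed
  show ?thesis
    using sums_integral_dominated[OF _ _ int sums] int_m bound by simp
qed

lemma integral_fps_exp_compose_sums:
  fixes T :: "real fps" and c :: real and h :: "real \<Rightarrow> real"
  assumes T0: "T $ 0 = 0" and M: "sets M = sets borel" and h[measurable]: "h \<in> borel_measurable M"
    and summ: "AE x in M. summable (\<lambda>j. norm (T $ j * x ^ j))"
    and int: "\<And>K. integrable M (\<lambda>x. \<bar>x\<bar> ^ K * exp (\<bar>c\<bar> * (\<Sum>j. norm (T $ j * x ^ j))) * \<bar>h x\<bar>)"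
  shows "(\<lambda>m. (fps_exp c oo T) $ m * (LINT x|M. x ^ (s + m) * h x))
      sums (LINT x|M. x ^ s * exp (c * (\<Sum>j. T $ j * x ^ j)) * h x)"
proof (rule sums_integral_power_series[OF M _ h _ _ int[of s]])
  note [measurable] = measurable_ident_sets[OF M]
  define A where "A = (\<lambda>x. exp (\<bar>c\<bar> * (\<Sum>j. norm (T $ j * x ^ j))))"
  have pointwise: "AE x in M. (\<lambda>m. (fps_exp c oo T) $ m * x ^ m) sums exp (c * (\<Sum>j. T $ j * x ^ j)) \<and>
      summable (\<lambda>m. norm ((fps_exp c oo T) $ m * x ^ m)) \<and>
      (\<Sum>m. norm ((fps_exp c oo T) $ m * x ^ m)) \<le> A x \<and> 1 \<le> A x"
    using summ
  proof eventually_elim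
    case (elim x)
    then have "0 \<le> \<bar>c\<bar> * (\<Sum>j. norm (T $ j * x ^ j))" by (simp add: suminf_nonneg)
    then show ?case using fps_exp_compose_eval_sums[OF T0 elim] by (simp add: A_def)
  qed
  then show "AE x in M. (\<lambda>m. (fps_exp c oo T) $ m * x ^ m) sums exp (c * (\<Sum>j. T $ j * x ^ j)) \<and>
      summable (\<lambda>m. norm ((fps_exp c oo T) $ m * x ^ m)) \<and>
      (\<Sum>m. norm ((fps_exp c oo T) $ m * x ^ m)) \<le> exp (\<bar>c\<bar> * (\<Sum>j. norm (T $ j * x ^ j)))"
    by (auto simp: A_def elim: AE_mp)
  show "integrable M (\<lambda>x. x ^ (s + m) * h x)" for m
  proof (rule Bochner_Integration.integrable_bound[OF int[of "s + m"]])
    show "AE x in M. norm (x ^ (s + m) * h x) \<le>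
        norm (\<bar>x\<bar> ^ (s + m) * exp (\<bar>c\<bar> * (\<Sum>j. norm (T $ j * x ^ j))) * \<bar>h x\<bar>)"
      using pointwise
    proof eventually_elim
      case (elim x)
      then have "\<bar>x\<bar> ^ (s + m) * \<bar>h x\<bar> * 1 \<le> \<bar>x\<bar> ^ (s + m) * \<bar>h x\<bar> * A x"
        by (intro mult_left_mono) auto
      then show ?case by (simp add: abs_mult power_abs mult_ac A_def)
    qed
  qed simp
qed (measurable, rule measurable_ident_sets[OF M])

subsection \<open>Deforming moment matrices\<close>

lemma imult_toeplitz_sums:
  assumes n: "composition n p"
    and sums: "(\<lambda>m. F (mo_a n p i) $ m * A (comp_index n p (mo_a n p i) (mo_k n p i + m)) j) sums s"
  shows "imult (toeplitz n p F) A i j = s"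
proof -
  define a k where "a = mo_a n p i" and "k = mo_k n p i"
  have a: "a \<in> {1..p}" using mo_a_in[OF n] by (simp add: a_def)
  define g where "g = (\<lambda>m. comp_index n p a (k + m))"
  have mono: "strict_mono g"
    using strict_mono_comp_index[OF n a] by (simp add: g_def strict_mono_def)
  have zero: "toeplitz n p F i l * A l j = 0" if "l \<notin> range g" for l
  proof (rule ccontr)
    assume "toeplitz n p F i l * A l j \<noteq> 0"
    then have "mo_a n p l = a" "k \<le> mo_k n p l"
      by (auto simp: toeplitz_def a_def k_def split: if_splits)
    then have "l = g (mo_k n p l - k)" using comp_index_mo[OF n, of l] by (simp add: g_def)
    with that show False by blast
  qed
  have "(\<lambda>m. toeplitz n p F i (g m) * A (g m) j) = (\<lambda>m. F a $ m * A (g m) j)"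
    using n a by (simp add: fun_eq_iff g_def toeplitz_comp_index a_def k_def)
  then have "(\<lambda>m. toeplitz n p F i (g m) * A (g m) j) sums s"
    using sums unfolding g_def a_def k_def by simp
  then have "(\<lambda>l. toeplitz n p F i l * A l j) sums s"
    using sums_mono_reindex[OF mono, of "\<lambda>l. toeplitz n p F i l * A l j"] zero by blast
  then show ?thesis by (simp add: imult_def sums_iff)
qed

lemma toeplitz_exp_mult_moment_matrix:
  fixes T :: "nat \<Rightarrow> real fps" and c :: real
  assumes n1: "composition n1 p1" and n2: "composition n2 p2"
    and "sets M = sets borel" and T0: "\<And>a. T a $ 0 = 0"
    and w1: "\<And>a. a \<in> {1..p1} \<Longrightarrow> w1 a \<in> borel_measurable M"
    and w2: "\<And>b. b \<in> {1..p2} \<Longrightarrow> w2 b \<in> borel_measurable M"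
    and summ: "\<And>a. a \<in> {1..p1} \<Longrightarrow> AE x in M. summable (\<lambda>j. norm (T a $ j * x ^ j))"
    and int: "\<And>a b K. a \<in> {1..p1} \<Longrightarrow> b \<in> {1..p2} \<Longrightarrow> integrable M (\<lambda>x.
      \<bar>x\<bar> ^ K * exp (\<bar>c\<bar> * (\<Sum>j. norm (T a $ j * x ^ j))) * \<bar>w1 a x * w2 b x\<bar>)"
  shows "imult (toeplitz n1 p1 (\<lambda>a. fps_exp c oo T a)) (moment_matrix M n1 p1 n2 p2 w1 w2) =
    moment_matrix M n1 p1 n2 p2 (\<lambda>a x. exp (c * (\<Sum>j. T a $ j * x ^ j)) * w1 a x) w2"
proof (intro ext imult_toeplitz_sums[OF n1])
  fix i j
  define a k b k' where "a = mo_a n1 p1 i" and "k = mo_k n1 p1 i"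
    and "b = mo_a n2 p2 j" and "k' = mo_k n2 p2 j"
  have a: "a \<in> {1..p1}" and b: "b \<in> {1..p2}"
    using mo_a_in[OF n1] mo_a_in[OF n2] by (simp_all add: a_def b_def)
  have "(\<lambda>m. (fps_exp c oo T a) $ m * (LINT x|M. x ^ (k + k' + m) * (w1 a x * w2 b x)))
      sums (LINT x|M. x ^ (k + k') * exp (c * (\<Sum>j. T a $ j * x ^ j)) * (w1 a x * w2 b x))"
    using a b assms(3) w1 w2 by (intro integral_fps_exp_compose_sums T0 summ int) auto
  then show "(\<lambda>m. (fps_exp c oo T (mo_a n1 p1 i)) $ m * moment_matrix M n1 p1 n2 p2 w1 w2
        (comp_index n1 p1 (mo_a n1 p1 i) (mo_k n1 p1 i + m)) j) sums
      moment_matrix M n1 p1 n2 p2 (\<lambda>a x. exp (c * (\<Sum>j. T a $ j * x ^ j)) * w1 a x) w2 i j"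
    using n1 a by (simp add: moment_matrix_def a_def k_def b_def k'_def add_ac mult_ac)
qed

lemma itrans_moment_matrix: "itrans (moment_matrix M n1 p1 n2 p2 w1 w2) = moment_matrix M n2 p2 n1 p1 w2 w1"
  by (simp add: fun_eq_iff itrans_def moment_matrix_def add.commute mult_ac)

lemma moment_matrix_mult_itrans_toeplitz_exp:
  fixes T :: "nat \<Rightarrow> real fps" and c :: real
  assumes n1: "composition n1 p1" and n2: "composition n2 p2"
    and "sets M = sets borel" and "\<And>b. T b $ 0 = 0"
    and "\<And>a. a \<in> {1..p1} \<Longrightarrow> w1 a \<in> borel_measurable M"
    and "\<And>b. b \<in> {1..p2} \<Longrightarrow> w2 b \<in> borel_measurable M"
    and "\<And>b. b \<in> {1..p2} \<Longrightarrow> AE x in M. summable (\<lambda>j. norm (T b $ j * x ^ j))"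
    and "\<And>b a K. b \<in> {1..p2} \<Longrightarrow> a \<in> {1..p1} \<Longrightarrow> integrable M (\<lambda>x.
      \<bar>x\<bar> ^ K * exp (\<bar>c\<bar> * (\<Sum>j. norm (T b $ j * x ^ j))) * \<bar>w2 b x * w1 a x\<bar>)"
  shows "imult (moment_matrix M n1 p1 n2 p2 w1 w2) (itrans (toeplitz n2 p2 (\<lambda>b. fps_exp c oo T b))) =
    moment_matrix M n1 p1 n2 p2 w1 (\<lambda>b x. exp (c * (\<Sum>j. T b $ j * x ^ j)) * w2 b x)"
proof -
  have "imult (moment_matrix M n1 p1 n2 p2 w1 w2) (itrans (toeplitz n2 p2 (\<lambda>b. fps_exp c oo T b))) =
      itrans (imult (toeplitz n2 p2 (\<lambda>b. fps_exp c oo T b)) (moment_matrix M n2 p2 n1 p1 w2 w1))"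
    using imult_itrans[of "moment_matrix M n2 p2 n1 p1 w2 w1"] by (simp add: itrans_moment_matrix)
  also have "imult (toeplitz n2 p2 (\<lambda>b. fps_exp c oo T b)) (moment_matrix M n2 p2 n1 p1 w2 w1) =
      moment_matrix M n2 p2 n1 p1 (\<lambda>b x. exp (c * (\<Sum>j. T b $ j * x ^ j)) * w2 b x) w1"
    using assms by (intro toeplitz_exp_mult_moment_matrix) auto
  also have "itrans \<dots> = moment_matrix M n1 p1 n2 p2 w1 (\<lambda>b x. exp (c * (\<Sum>j. T b $ j * x ^ j)) * w2 b x)"
    by (rule itrans_moment_matrix)
  finally show ?thesis .
qed

lemma suminf_shift_time_fps:
  fixes f :: "real \<Rightarrow> real"
  assumes "f 0 = 0"
  shows "(\<Sum>j. f (time_fps t a $ j * x ^ j)) = (\<Sum>j. f (t (Suc j) a * x ^ Suc j))"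
proof -
  have "n = 0" if "n \<notin> range Suc" for n
    using that by (cases n) auto
  then have "(\<Sum>j. f (time_fps t a $ Suc j * x ^ Suc j)) = (\<Sum>j. f (time_fps t a $ j * x ^ j))"
    using assms by (intro suminf_mono_reindex) (auto simp: strict_mono_Suc_iff time_fps_nth)
  then show ?thesis by (simp add: time_fps_nth)
qed

lemma summable_norm_time_fps_iff:
  "summable (\<lambda>j. norm (time_fps t a $ j * x ^ j)) \<longleftrightarrow> summable (\<lambda>j. \<bar>t (Suc j) a * x ^ Suc j\<bar>)"
  using summable_Suc_iff[of "\<lambda>j. norm (time_fps t a $ j * x ^ j)"] by (simp add: time_fps_nth)

lemma integrable_drop_exp_factor:
  fixes r s :: "nat \<Rightarrow> real" and u :: "real \<Rightarrow> real"
  assumes "sets M = sets borel" and [measurable]: "u \<in> borel_measurable M"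
    and summ: "AE x in M. summable (\<lambda>j. \<bar>s j * x ^ Suc j\<bar>)"
    and int: "integrable M (\<lambda>x. \<bar>x\<bar> ^ K * exp (\<Sum>j. \<bar>r j * x ^ Suc j\<bar>) * exp (\<Sum>j. \<bar>s j * x ^ Suc j\<bar>) * \<bar>u x\<bar>)"
  shows "integrable M (\<lambda>x. \<bar>x\<bar> ^ K * exp (\<Sum>j. \<bar>r j * x ^ Suc j\<bar>) * \<bar>u x\<bar>)"
proof (rule Bochner_Integration.integrable_bound[OF int])
  note [measurable] = measurable_ident_sets[OF assms(1)]
  show "(\<lambda>x. \<bar>x\<bar> ^ K * exp (\<Sum>j. \<bar>r j * x ^ Suc j\<bar>) * \<bar>u x\<bar>) \<in> borel_measurable M"
    by measurable
  show "AE x in M. norm (\<bar>x\<bar> ^ K * exp (\<Sum>j. \<bar>r j * x ^ Suc j\<bar>) * \<bar>u x\<bar>)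
      \<le> norm (\<bar>x\<bar> ^ K * exp (\<Sum>j. \<bar>r j * x ^ Suc j\<bar>) * exp (\<Sum>j. \<bar>s j * x ^ Suc j\<bar>) * \<bar>u x\<bar>)"
    using summ
  proof eventually_elim
    case (elim x)
    define A B where "A = exp (\<Sum>j. \<bar>r j * x ^ Suc j\<bar>)" and "B = exp (\<Sum>j. \<bar>s j * x ^ Suc j\<bar>)"
    have "1 \<le> B" using elim by (simp add: B_def suminf_nonneg)
    then have "\<bar>x\<bar> ^ K * A * \<bar>u x\<bar> * 1 \<le> \<bar>x\<bar> ^ K * A * \<bar>u x\<bar> * B"
      by (intro mult_left_mono) (auto simp: A_def)
    moreover have "0 < A" "0 < B" by (simp_all add: A_def B_def)
    ultimately show ?case
      unfolding A_def[symmetric] B_def[symmetric] by (simp add: abs_mult mult_ac)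
  qed
qed

lemma integrable_absorb_exp_factor:
  fixes r s :: "nat \<Rightarrow> real" and u v :: "real \<Rightarrow> real"
  assumes "sets M = sets borel" and [measurable]: "u \<in> borel_measurable M" "v \<in> borel_measurable M"
    and summ: "AE x in M. summable (\<lambda>j. \<bar>r j * x ^ Suc j\<bar>)"
    and int: "integrable M (\<lambda>x. \<bar>x\<bar> ^ K * exp (\<Sum>j. \<bar>r j * x ^ Suc j\<bar>) * exp (\<Sum>j. \<bar>s j * x ^ Suc j\<bar>) * \<bar>u x * v x\<bar>)"
  shows "integrable M (\<lambda>x. \<bar>x\<bar> ^ K * exp (\<Sum>j. \<bar>s j * x ^ Suc j\<bar>) * \<bar>v x * (exp (\<Sum>j. r j * x ^ Suc j) * u x)\<bar>)"
proof (rule Bochner_Integration.integrable_bound[OF int])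
  note [measurable] = measurable_ident_sets[OF assms(1)]
  show "(\<lambda>x. \<bar>x\<bar> ^ K * exp (\<Sum>j. \<bar>s j * x ^ Suc j\<bar>) * \<bar>v x * (exp (\<Sum>j. r j * x ^ Suc j) * u x)\<bar>)
      \<in> borel_measurable M"
    by measurable
  show "AE x in M. norm (\<bar>x\<bar> ^ K * exp (\<Sum>j. \<bar>s j * x ^ Suc j\<bar>) * \<bar>v x * (exp (\<Sum>j. r j * x ^ Suc j) * u x)\<bar>)
      \<le> norm (\<bar>x\<bar> ^ K * exp (\<Sum>j. \<bar>r j * x ^ Suc j\<bar>) * exp (\<Sum>j. \<bar>s j * x ^ Suc j\<bar>) * \<bar>u x * v x\<bar>)"
    using summ
  proof eventually_elim
    case (elim x)
    have "(\<Sum>j. r j * x ^ Suc j) \<le> (\<Sum>j. \<bar>r j * x ^ Suc j\<bar>)"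
      by (rule suminf_le[OF _ summable_rabs_cancel[OF elim] elim]) simp
    then have "exp (\<Sum>j. r j * x ^ Suc j) \<le> exp (\<Sum>j. \<bar>r j * x ^ Suc j\<bar>)" by simp
    moreover define E A B where "E = exp (\<Sum>j. r j * x ^ Suc j)" and "A = exp (\<Sum>j. \<bar>r j * x ^ Suc j\<bar>)"
      and "B = exp (\<Sum>j. \<bar>s j * x ^ Suc j\<bar>)"
    ultimately have "\<bar>x\<bar> ^ K * B * \<bar>u x * v x\<bar> * E \<le> \<bar>x\<bar> ^ K * B * \<bar>u x * v x\<bar> * A"
      by (intro mult_left_mono) (auto simp: B_def)
    moreover have "0 < E" "0 < A" "0 < B" by (simp_all add: E_def A_def B_def)
    ultimately show ?case
      unfolding E_def[symmetric] A_def[symmetric] B_def[symmetric] by (simp add: abs_mult mult_ac)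
  qed
qed

lemma W0_mult_moment_matrix:
  fixes t tb :: "nat \<Rightarrow> nat \<Rightarrow> real"
  assumes n1: "composition n1 p1" and n2: "composition n2 p2" and M: "sets M = sets borel"
    and w1: "\<And>a. a \<in> {1..p1} \<Longrightarrow> w1 a \<in> borel_measurable M"
    and w2: "\<And>b. b \<in> {1..p2} \<Longrightarrow> w2 b \<in> borel_measurable M"
    and summ: "\<And>a. a \<in> {1..p1} \<Longrightarrow> AE x in M. summable (\<lambda>j. \<bar>t (Suc j) a * x ^ Suc j\<bar>)"
    and summ': "\<And>b. b \<in> {1..p2} \<Longrightarrow> AE x in M. summable (\<lambda>j. \<bar>tb (Suc j) b * x ^ Suc j\<bar>)"
    and int: "\<And>a b K. a \<in> {1..p1} \<Longrightarrow> b \<in> {1..p2} \<Longrightarrow> integrable M (\<lambda>x.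
      \<bar>x\<bar> ^ K * exp (\<Sum>j. \<bar>t (Suc j) a * x ^ Suc j\<bar>) * exp (\<Sum>j. \<bar>tb (Suc j) b * x ^ Suc j\<bar>)
      * \<bar>w1 a x * w2 b x\<bar>)"
  shows "imult (W0 n1 p1 t) (moment_matrix M n1 p1 n2 p2 w1 w2) =
    moment_matrix M n1 p1 n2 p2 (\<lambda>a x. exp (\<Sum>j. t (Suc j) a * x ^ Suc j) * w1 a x) w2"
proof -
  have "imult (toeplitz n1 p1 (\<lambda>a. fps_exp 1 oo time_fps t a)) (moment_matrix M n1 p1 n2 p2 w1 w2) =
      moment_matrix M n1 p1 n2 p2 (\<lambda>a x. exp (1 * (\<Sum>j. time_fps t a $ j * x ^ j)) * w1 a x) w2"
  proof (rule toeplitz_exp_mult_moment_matrix[OF n1 n2 M _ w1 w2])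
    show "AE x in M. summable (\<lambda>j. norm (time_fps t a $ j * x ^ j))" if "a \<in> {1..p1}" for a
      unfolding summable_norm_time_fps_iff using summ[OF that] .
    show "integrable M (\<lambda>x. \<bar>x\<bar> ^ K * exp (\<bar>1\<bar> * (\<Sum>j. norm (time_fps t a $ j * x ^ j)))
        * \<bar>w1 a x * w2 b x\<bar>)" if "a \<in> {1..p1}" "b \<in> {1..p2}" for a b K
    proof -
      have "(\<lambda>x. w1 a x * w2 b x) \<in> borel_measurable M"
        using w1[OF that(1)] w2[OF that(2)] by measurable
      from integrable_drop_exp_factor[OF M this summ'[OF that(2)] int[OF that]] show ?thesis
        by (simp only: real_norm_def suminf_shift_time_fps[of abs] abs_zero abs_one mult_1_left)
    qed
  qed (simp add: time_fps_nth)
  then show ?thesis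
    by (simp only: W0_eq_toeplitz[OF n1] suminf_shift_time_fps[of "\<lambda>y. y"] mult_1_left)
qed

lemma moment_matrix_mult_iinv_Wbar0:
  fixes tb :: "nat \<Rightarrow> nat \<Rightarrow> real"
  assumes n1: "composition n1 p1" and n2: "composition n2 p2" and M: "sets M = sets borel"
    and v: "\<And>a. a \<in> {1..p1} \<Longrightarrow> v a \<in> borel_measurable M"
    and w2: "\<And>b. b \<in> {1..p2} \<Longrightarrow> w2 b \<in> borel_measurable M"
    and summ: "\<And>b. b \<in> {1..p2} \<Longrightarrow> AE x in M. summable (\<lambda>j. \<bar>tb (Suc j) b * x ^ Suc j\<bar>)"
    and int: "\<And>b a K. b \<in> {1..p2} \<Longrightarrow> a \<in> {1..p1} \<Longrightarrow> integrable M (\<lambda>x.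
      \<bar>x\<bar> ^ K * exp (\<Sum>j. \<bar>tb (Suc j) b * x ^ Suc j\<bar>) * \<bar>w2 b x * v a x\<bar>)"
  shows "imult (moment_matrix M n1 p1 n2 p2 v w2) (iinv_lower (Wbar0 n2 p2 tb)) =
    moment_matrix M n1 p1 n2 p2 v (\<lambda>b x. inverse (exp (\<Sum>j. tb (Suc j) b * x ^ Suc j)) * w2 b x)"
proof -
  have "iinv_lower (Wbar0 n2 p2 tb) = itrans (toeplitz n2 p2 (\<lambda>b. fps_exp (-1) oo time_fps tb b))"
    unfolding Wbar0_eq_itrans_toeplitz[OF n2]
    by (intro iinv_lower_itrans_toeplitz n2 fps_exp_compose_mult_inverse) (simp add: time_fps_nth)
  moreover have "imult (moment_matrix M n1 p1 n2 p2 v w2) (itrans (toeplitz n2 p2 (\<lambda>b. fps_exp (-1) oo time_fps tb b))) =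
      moment_matrix M n1 p1 n2 p2 v (\<lambda>b x. exp (-1 * (\<Sum>j. time_fps tb b $ j * x ^ j)) * w2 b x)"
  proof (rule moment_matrix_mult_itrans_toeplitz_exp[OF n1 n2 M _ v w2])
    show "AE x in M. summable (\<lambda>j. norm (time_fps tb b $ j * x ^ j))" if "b \<in> {1..p2}" for b
      unfolding summable_norm_time_fps_iff using summ[OF that] .
    show "integrable M (\<lambda>x. \<bar>x\<bar> ^ K * exp (\<bar>-1\<bar> * (\<Sum>j. norm (time_fps tb b $ j * x ^ j)))
        * \<bar>w2 b x * v a x\<bar>)" if "b \<in> {1..p2}" "a \<in> {1..p1}" for b a K
      using int[OF that]
      by (simp only: real_norm_def suminf_shift_time_fps[of abs] abs_zero abs_neg_one mult_1_left)
  qed (simp add: time_fps_nth)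
  ultimately show ?thesis
    by (simp only: suminf_shift_time_fps[of "\<lambda>y. y"] mult_minus1 exp_minus)
qed

theorem theorem3p1:
  fixes M :: "real measure" and p1 p2 :: nat and n1 n2 :: "nat \<Rightarrow> nat"
    and w1 w2 :: "nat \<Rightarrow> real \<Rightarrow> real" and t tb :: "nat \<Rightarrow> nat \<Rightarrow> real"
  assumes "finite_measure M" and "sets M = sets borel"
    and "p1 \<ge> 1" and "p2 \<ge> 1"
    and "\<forall>a\<in>{1..p1}. n1 a \<ge> 1" and "\<forall>b\<in>{1..p2}. n2 b \<ge> 1"
    and "\<forall>a\<in>{1..p1}. w1 a \<in> borel_measurable M"
    and "\<forall>b\<in>{1..p2}. w2 b \<in> borel_measurable M"
    and "\<forall>a\<in>{1..p1}. AE x in M. summable (\<lambda>j. \<bar>t (Suc j) a * x ^ Suc j\<bar>)"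
    and "\<forall>b\<in>{1..p2}. AE x in M. summable (\<lambda>j. \<bar>tb (Suc j) b * x ^ Suc j\<bar>)"
    and "\<forall>a\<in>{1..p1}. \<forall>b\<in>{1..p2}. \<forall>K::nat. integrable M (\<lambda>x.
           \<bar>x\<bar> ^ K * exp (\<Sum>j. \<bar>t (Suc j) a * x ^ Suc j\<bar>) * exp (\<Sum>j. \<bar>tb (Suc j) b * x ^ Suc j\<bar>)
           * \<bar>w1 a x * w2 b x\<bar>)"
  shows "imult (imult (W0 n1 p1 t) (moment_matrix M n1 p1 n2 p2 w1 w2)) (iinv_lower (Wbar0 n2 p2 tb))
       = moment_matrix M n1 p1 n2 p2
           (\<lambda>a x. exp (\<Sum>j. t (Suc j) a * x ^ Suc j) * w1 a x)
           (\<lambda>b x. inverse (exp (\<Sum>j. tb (Suc j) b * x ^ Suc j)) * w2 b x)"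
proof -
  have n1: "composition n1 p1" and n2: "composition n2 p2"
    using assms(3-6) by (simp_all add: composition_def)
  have left: "imult (W0 n1 p1 t) (moment_matrix M n1 p1 n2 p2 w1 w2) =
      moment_matrix M n1 p1 n2 p2 (\<lambda>a x. exp (\<Sum>j. t (Suc j) a * x ^ Suc j) * w1 a x) w2"
    using assms(7-11) by (intro W0_mult_moment_matrix[OF n1 n2 assms(2)]) auto
  have "imult (moment_matrix M n1 p1 n2 p2 (\<lambda>a x. exp (\<Sum>j. t (Suc j) a * x ^ Suc j) * w1 a x) w2)
      (iinv_lower (Wbar0 n2 p2 tb)) = moment_matrix M n1 p1 n2 p2
        (\<lambda>a x. exp (\<Sum>j. t (Suc j) a * x ^ Suc j) * w1 a x)
        (\<lambda>b x. inverse (exp (\<Sum>j. tb (Suc j) b * x ^ Suc j)) * w2 b x)"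
  proof (rule moment_matrix_mult_iinv_Wbar0[OF n1 n2 assms(2)])
    show "(\<lambda>x. exp (\<Sum>j. t (Suc j) a * x ^ Suc j) * w1 a x) \<in> borel_measurable M" if "a \<in> {1..p1}" for a
    proof -
      note [measurable] = measurable_ident_sets[OF assms(2)] assms(7)[rule_format, OF that]
      show ?thesis by measurable
    qed
    show "integrable M (\<lambda>x. \<bar>x\<bar> ^ K * exp (\<Sum>j. \<bar>tb (Suc j) b * x ^ Suc j\<bar>)
        * \<bar>w2 b x * (exp (\<Sum>j. t (Suc j) a * x ^ Suc j) * w1 a x)\<bar>)"
      if "b \<in> {1..p2}" "a \<in> {1..p1}" for a b K
      using assms(7-11) that by (intro integrable_absorb_exp_factor[OF assms(2)]) auto
  qed (use assms(8,10) in auto)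
  with left show ?thesis by simp
qed

end
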